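(* There exists a $3$-connected planar graph $G$ that is not a complete graph and that is not degree-truncated $8$-choosable.
   Context: All graphs are finite and simple. A list assignment $L$ of a graph $G$ assigns to each vertex $v$ a set $L(v)$ of colours; an $L$-colouring is a map $\phi$ with $\phi(v)\in L(v)$ for all $v$ and $\phi(u)\neq\phi(v)$ for every edge $uv$. For $f:V(G)\to\mathbb{N}$, an $f$-list assignment is a list assignment with $|L(v)|\ge f(v)$ for all $v$, and $G$ is $f$-choosable if it is $L$-colourable for every $f$-list assignment $L$. For a positive integer $k$, $G$ is degree-truncated $k$-choosable if $G$ is $f$-choosable for $f(v)=\min\{k,d_G(v)\}$, where $d_G(v)$ is the degree of $v$ in $G$. *)

theory Defs
  imports "HOL-Analysis.Analysis"
begin

text \<open>Finite simple graphs with vertex set V (a finite set of naturals) and edge set E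
  (a set of 2-element subsets of V).\<close>

definition simple_graph :: "nat set \<Rightarrow> nat set set \<Rightarrow> bool" where
  "simple_graph V E \<longleftrightarrow> finite V \<and>
     (\<forall>e\<in>E. \<exists>u v. u \<noteq> v \<and> u \<in> V \<and> v \<in> V \<and> e = {u, v})"

definition degree :: "nat set \<Rightarrow> nat set set \<Rightarrow> nat \<Rightarrow> nat" where
  "degree V E v = card {u \<in> V. {u, v} \<in> E}"

definition complete_graph :: "nat set \<Rightarrow> nat set set \<Rightarrow> bool" where
  "complete_graph V E \<longleftrightarrow> (\<forall>u\<in>V. \<forall>v\<in>V. u \<noteq> v \<longrightarrow> {u, v} \<in> E)"

text \<open>Connectedness: any two vertices are joined by a walk (reflexive-transitive closure
  of adjacency inside V).\<close>

definition adj_rel :: "nat set \<Rightarrow> nat set set \<Rightarrow> (nat \<times> nat) set" where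
  "adj_rel V E = {(u, v). u \<in> V \<and> v \<in> V \<and> {u, v} \<in> E}"

definition connected_graph :: "nat set \<Rightarrow> nat set set \<Rightarrow> bool" where
  "connected_graph V E \<longleftrightarrow> V \<noteq> {} \<and> (\<forall>u\<in>V. \<forall>v\<in>V. (u, v) \<in> (adj_rel V E)\<^sup>*)"

text \<open>k-connected: more than k vertices, and removing fewer than k vertices leaves
  the graph connected.\<close>
definition k_connected :: "nat \<Rightarrow> nat set \<Rightarrow> nat set set \<Rightarrow> bool" where
  "k_connected k V E \<longleftrightarrow> card V > k \<and>
     (\<forall>S \<subseteq> V. card S < k \<longrightarrow> connected_graph (V - S) {e \<in> E. e \<inter> S = {}})"

text \<open>Planarity: a drawing in the plane (= complex numbers) with distinct points for the
  vertices and arcs for the edges, where an arc meets a vertex point only at its own endpoints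
  and two distinct arcs meet only in common endpoints.\<close>
definition planar :: "nat set \<Rightarrow> nat set set \<Rightarrow> bool" where
  "planar V E \<longleftrightarrow> (\<exists>(p :: nat \<Rightarrow> complex) (\<gamma> :: nat set \<Rightarrow> real \<Rightarrow> complex).
     inj_on p V \<and>
     (\<forall>e\<in>E. arc (\<gamma> e) \<and> {pathstart (\<gamma> e), pathfinish (\<gamma> e)} = p ` e) \<and>
     (\<forall>e\<in>E. \<forall>v\<in>V. p v \<in> path_image (\<gamma> e) \<longrightarrow> v \<in> e) \<and>
     (\<forall>e\<in>E. \<forall>e'\<in>E. e \<noteq> e' \<longrightarrow> path_image (\<gamma> e) \<inter> path_image (\<gamma> e') \<subseteq> p ` (e \<inter> e')))"

text \<open>List colouring (colours are natural numbers).\<close>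
definition L_colouring :: "nat set \<Rightarrow> nat set set \<Rightarrow> (nat \<Rightarrow> nat set) \<Rightarrow> (nat \<Rightarrow> nat) \<Rightarrow> bool" where
  "L_colouring V E L \<phi> \<longleftrightarrow> (\<forall>v\<in>V. \<phi> v \<in> L v) \<and> (\<forall>u v. {u, v} \<in> E \<longrightarrow> \<phi> u \<noteq> \<phi> v)"

definition f_list_assignment :: "nat set \<Rightarrow> (nat \<Rightarrow> nat) \<Rightarrow> (nat \<Rightarrow> nat set) \<Rightarrow> bool" where
  "f_list_assignment V f L \<longleftrightarrow> (\<forall>v\<in>V. finite (L v) \<and> f v \<le> card (L v))"

definition f_choosable :: "nat set \<Rightarrow> nat set set \<Rightarrow> (nat \<Rightarrow> nat) \<Rightarrow> bool" where
  "f_choosable V E f \<longleftrightarrow> (\<forall>L. f_list_assignment V f L \<longrightarrow> (\<exists>\<phi>. L_colouring V E L \<phi>))"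

definition degree_truncated_choosable :: "nat \<Rightarrow> nat set \<Rightarrow> nat set set \<Rightarrow> bool" where
  "degree_truncated_choosable k V E \<longleftrightarrow> f_choosable V E (\<lambda>v. min k (degree V E v))"

end

theory Submission
  imports Defs
begin

text \<open>
  The graph is a stacked triangulation: starting from a triangle, vertices are repeatedly inserted
  into triangular faces and joined to the three corners. Placing each new vertex at the centroid
  of its face gives a straight-line drawing, and since each new vertex has three neighbours the
  graph stays 3-connected.

  Five vertices of degree at most 7 inserted into a face with corners \<open>p\<close>, \<open>z\<close>, \<open>t\<close> can forbid all
  colourings with \<open>p\<close> coloured \<open>\<alpha>\<close>, \<open>z\<close> coloured from \<open>A\<close> and \<open>t\<close> from \<open>B\<close>, for disjoint sets \<open>A\<close>, \<open>B\<close>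
  of size 3. Given colours \<open>\<alpha>\<close>, \<open>\<beta>\<close> of two poles \<open>p\<close>, \<open>q\<close>, consider a path \<open>a\<close>, \<open>z\<close>, \<open>b\<close> of common
  neighbours of \<open>p\<close> and \<open>q\<close> with lists \<open>{\<alpha>, \<beta>} \<union> C \<union> D\<close>, \<open>{\<alpha>, \<beta>} \<union> A \<union> B\<close>, \<open>{\<alpha>, \<beta>} \<union> C \<union> D\<close>. Gadgets in
  the two faces at the edge \<open>za\<close> forbid \<open>B \<times> C\<close> and \<open>B \<times> D\<close>, those in the two faces at \<open>zb\<close> forbid
  \<open>A \<times> C\<close> and \<open>A \<times> D\<close>; hence no colour is left for \<open>z\<close>. Since a free face at the edge \<open>pq\<close>
  remains, this can be repeated for all 64 pairs \<open>(\<alpha>, \<beta>)\<close>.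
\<close>

section \<open>Barycentric coordinates in a triangle\<close>

text \<open>Subtracting the two representations and eliminating the weight of \<open>a\<close>
  leaves a linear relation between \<open>b - a\<close> and \<open>c - a\<close>, which are
  independent because the corners are not collinear.\<close>

lemma noncollinear_barycentric_unique:
  fixes a b c :: complex
  assumes nc: "\<not> collinear {a, b, c}"
    and eq: "x *\<^sub>R a + y *\<^sub>R b + z *\<^sub>R c = x' *\<^sub>R a + y' *\<^sub>R b + z' *\<^sub>R c"
    and s: "x + y + z = 1" "x' + y' + z' = 1"
  shows "x = x' \<and> y = y' \<and> z = z'"
proof -
  have x: "x = 1 - y - z" "x' = 1 - y' - z'" using s by auto
  have 1: "(y - y') *\<^sub>R (b - a) + (z - z') *\<^sub>R (c - a) = 0"
    using eq unfolding x by (simp add: algebra_simps)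
  have nc': "\<not> collinear {0, b - a, c - a}"
    using nc collinear_3[of b a c] by (simp add: insert_commute)
  have "z = z'"
  proof (rule ccontr)
    assume "z \<noteq> z'"
    have "(z - z') *\<^sub>R (c - a) = (y' - y) *\<^sub>R (b - a)"
      using 1 by (simp add: algebra_simps)
    hence "c - a = inverse (z - z') *\<^sub>R (y' - y) *\<^sub>R (b - a)"
      using \<open>z \<noteq> z'\<close> by (metis eq_iff_diff_eq_0 left_inverse scaleR_one scaleR_scaleR)
    hence "c - a = (inverse (z - z') * (y' - y)) *\<^sub>R (b - a)" by simp
    thus False using nc' unfolding collinear_lemma by blast
  qed
  moreover have "b - a \<noteq> 0" using nc' by (auto simp: collinear_lemma)
  ultimately have "y = y'" using 1 by simp
  with \<open>z = z'\<close> x show ?thesis by simp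
qed

text \<open>The open triangle, taken as a function of the set of corners: faces are sets of
  vertices, so no order of the corners has to be chosen.\<close>

definition tri :: "complex set \<Rightarrow> complex set" where
  "tri X = interior (convex hull X)"

lemma tri_3:
  assumes "\<not> collinear {a, b, c :: complex}"
  shows "v \<in> tri {a, b, c} \<longleftrightarrow>
    (\<exists>x y z. 0 < x \<and> 0 < y \<and> 0 < z \<and> x + y + z = 1 \<and> x *\<^sub>R a + y *\<^sub>R b + z *\<^sub>R c = v)"
  using interior_convex_hull_3_minimal[OF assms] unfolding tri_def by auto

definition centroid :: "complex \<Rightarrow> complex \<Rightarrow> complex \<Rightarrow> complex" where
  "centroid a b c = (1/3) *\<^sub>R a + (1/3) *\<^sub>R b + (1/3) *\<^sub>R c"

context
  fixes a b c :: complex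
  assumes nc: "\<not> collinear {a, b, c}"
begin

lemmas bary = noncollinear_barycentric_unique[OF nc]

lemma side_Int_side: "convex hull {a, b} \<inter> convex hull {a, c} \<subseteq> {a}"
proof
  fix v assume "v \<in> convex hull {a, b} \<inter> convex hull {a, c}"
  then obtain x y x' z' where h: "v = x *\<^sub>R a + y *\<^sub>R b" "x + y = 1"
     "v = x' *\<^sub>R a + z' *\<^sub>R c" "x' + z' = 1" unfolding convex_hull_2 by blast
  have "x = x' \<and> y = 0 \<and> 0 = z'" by (rule bary) (use h in auto)
  thus "v \<in> {a}" using h by simp
qed

text \<open>The coordinate of \<open>c\<close> vanishes on the side and is positive in the open
  triangle.\<close>

lemma side_Int_tri: "convex hull {a, b} \<inter> tri {a, b, c} = {}"
proof -
  { fix v assume "v \<in> convex hull {a, b}" "v \<in> tri {a, b, c}"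
    then obtain x y x' y' z' where h: "v = x *\<^sub>R a + y *\<^sub>R b" "x + y = 1"
      "x' *\<^sub>R a + y' *\<^sub>R b + z' *\<^sub>R c = v" "x' + y' + z' = 1" "z' > 0"
      unfolding convex_hull_2 tri_3[OF nc] by auto
    have "x = x' \<and> y = y' \<and> 0 = z'" by (rule bary) (use h in auto)
    hence False using h by simp }
  thus ?thesis by auto
qed

lemma opposite_notin_side: "c \<notin> convex hull {a, b}"
proof
  assume "c \<in> convex hull {a, b}"
  then obtain x y where h: "c = x *\<^sub>R a + y *\<^sub>R b" "x + y = 1" unfolding convex_hull_2 by auto
  have "x = 0 \<and> y = 0 \<and> 0 = (1::real)" by (rule bary) (use h in auto)
  thus False by simp
qed

lemma centroid_in: "centroid a b c \<in> tri {a, b, c}"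
  unfolding tri_3[OF nc]
  by (rule exI[of _ "1/3"], rule exI[of _ "1/3"], rule exI[of _ "1/3"]) (simp add: centroid_def)

lemma spoke_subset: "convex hull {centroid a b c, a} \<subseteq> insert a (tri {a, b, c})"
proof
  fix v assume "v \<in> convex hull {centroid a b c, a}"
  then obtain x y where h: "v = x *\<^sub>R centroid a b c + y *\<^sub>R a" "0 \<le> x" "0 \<le> y" "x + y = 1"
    unfolding convex_hull_2 by auto
  show "v \<in> insert a (tri {a, b, c})"
  proof (cases "x = 0")
    case False
    \<comment> \<open>A point \<open>x\<close> centroid + \<open>y\<close> \<open>a\<close> has
      coordinates x/3 + y, x/3, x/3, all positive once \<open>x\<close> is nonzero; the simplifier
      supplies the third.\<close>
    hence "v \<in> tri {a, b, c}" unfolding tri_3[OF nc] using h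
      by (intro exI[of _ "x/3 + y"] exI[of _ "x/3"]) (auto simp: centroid_def scaleR_add_left scaleR_add_right)
    thus ?thesis by simp
  qed (use h in simp)
qed

text \<open>On the line through \<open>a\<close> and \<open>b\<close> the coordinate of
  \<open>c\<close> is 0, but at the centroid it is 1/3.\<close>

lemma noncollinear_centroid: "\<not> collinear {centroid a b c, a, b}"
proof
  assume "collinear {centroid a b c, a, b}"
  hence "collinear {a, b, centroid a b c}" by (simp add: insert_commute)
  hence "collinear {0, b - a, centroid a b c - a}"
    using collinear_3[of b a "centroid a b c"] by (simp add: insert_commute)
  moreover have "b - a \<noteq> 0" using nc by auto
  ultimately obtain r where r: "centroid a b c - a = r *\<^sub>R (b - a)"
    unfolding collinear_lemma by (metis scaleR_zero_left)
  hence "centroid a b c = a + r *\<^sub>R (b - a)" by (metis diff_add_cancel add.commute)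
  hence r': "centroid a b c = (1 - r) *\<^sub>R a + r *\<^sub>R b + 0 *\<^sub>R c" by (simp add: algebra_simps)
  have "1/3 = 1 - r \<and> 1/3 = r \<and> 1/3 = (0::real)"
    by (rule bary) (use r' in \<open>auto simp: centroid_def\<close>)
  thus False by simp
qed

text \<open>The small triangle at the side \<open>ab\<close> lies where the coordinate of
  \<open>c\<close> is strictly the smallest. This criterion separates it from the opposite spoke and
  from the other small triangles.\<close>

lemma tri_centroid_coords:
  assumes "v \<in> tri {centroid a b c, a, b}"
  obtains x y z where "z < x" "z < y" "0 < z" "x + y + z = 1" "v = x *\<^sub>R a + y *\<^sub>R b + z *\<^sub>R c"
proof -
  obtain x y z where h: "0 < x" "0 < y" "0 < z" "x + y + z = 1" "x *\<^sub>R centroid a b c + y *\<^sub>R a + z *\<^sub>R b = v"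
    using assms unfolding tri_3[OF noncollinear_centroid] by auto
  show ?thesis
    by (rule that[of "x/3" "x/3 + y" "x/3 + z"]) (use h in \<open>auto simp: centroid_def scaleR_add_left scaleR_add_right\<close>)
qed

lemma tri_centroid_subset: "tri {centroid a b c, a, b} \<subseteq> tri {a, b, c}"
proof
  fix v assume "v \<in> tri {centroid a b c, a, b}"
  then obtain x y z where h: "z < x" "z < y" "0 < z" "x + y + z = 1"
    "v = x *\<^sub>R a + y *\<^sub>R b + z *\<^sub>R c" by (rule tri_centroid_coords)
  show "v \<in> tri {a, b, c}" unfolding tri_3[OF nc]
    by (rule exI[of _ x], rule exI[of _ y], rule exI[of _ z]) (use h in auto)
qed

text \<open>On the spoke to \<open>c\<close> the coordinate of \<open>c\<close> is at least as large
  as the other two.\<close>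

lemma tri_centroid_Int_spoke: "tri {centroid a b c, a, b} \<inter> convex hull {centroid a b c, c} = {}"
proof -
  { fix v assume "v \<in> tri {centroid a b c, a, b}" "v \<in> convex hull {centroid a b c, c}"
    obtain x y z where h: "z < x" "z < y" "0 < z" "x + y + z = 1"
      "v = x *\<^sub>R a + y *\<^sub>R b + z *\<^sub>R c" using \<open>v \<in> tri {centroid a b c, a, b}\<close> by (rule tri_centroid_coords)
    obtain x' y' where h': "v = x' *\<^sub>R centroid a b c + y' *\<^sub>R c" "0 \<le> x'" "0 \<le> y'" "x' + y' = 1"
      using \<open>v \<in> convex hull {centroid a b c, c}\<close> unfolding convex_hull_2 by auto
    have "v = (x'/3) *\<^sub>R a + (x'/3) *\<^sub>R b + (x'/3 + y') *\<^sub>R c"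
      using h'(1) by (simp add: centroid_def scaleR_add_left scaleR_add_right)
    hence "x = x'/3 \<and> y = x'/3 \<and> z = x'/3 + y'" by (intro bary) (use h h' in auto)
    hence False using h h' by simp }
  thus ?thesis by auto
qed

end

text \<open>The strictly smallest coordinate would have to belong to both \<open>c\<close> and
  \<open>b\<close>. The coordinate lemma is applied to two orders of the corners, hence the place
  outside the context that fixes them.\<close>

lemma tri_centroid_disjoint:
  fixes a b c :: complex
  assumes nc: "\<not> collinear {a, b, c}"
  shows "tri {centroid a b c, a, b} \<inter> tri {centroid a b c, a, c} = {}"
proof -
  have nc': "\<not> collinear {a, c, b}" using nc by (simp add: insert_commute)
  have m': "centroid a b c = centroid a c b" by (simp add: centroid_def)
  { fix v assume "v \<in> tri {centroid a b c, a, b}" "v \<in> tri {centroid a b c, a, c}"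
    obtain x y z where h: "z < x" "z < y" "0 < z" "x + y + z = 1"
      "v = x *\<^sub>R a + y *\<^sub>R b + z *\<^sub>R c"
      using \<open>v \<in> tri {centroid a b c, a, b}\<close> by (rule tri_centroid_coords[OF nc])
    obtain x' y' z' where h': "z' < x'" "z' < y'" "0 < z'" "x' + y' + z' = 1"
      "v = x' *\<^sub>R a + y' *\<^sub>R c + z' *\<^sub>R b"
      using \<open>v \<in> tri {centroid a b c, a, c}\<close> unfolding m' by (rule tri_centroid_coords[OF nc'])
    have "x = x' \<and> y = z' \<and> z = y'"
      by (rule noncollinear_barycentric_unique[OF nc]) (use h h' in \<open>auto simp: algebra_simps\<close>)
    hence False using h h' by simp }
  thus ?thesis by auto
qed

section \<open>Stacked triangulations\<close>

text \<open>The third argument collects the bounded faces only, those in which a further vertex may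
  be placed; the outer face is never subdivided.\<close>

inductive stacked :: "nat set \<Rightarrow> nat set set \<Rightarrow> nat set set \<Rightarrow> bool" where
  triangle: "card f = 3 \<Longrightarrow> stacked f {e. \<exists>u\<in>f. \<exists>v\<in>f. u \<noteq> v \<and> e = {u, v}} {f}"
| insert: "stacked V E F \<Longrightarrow> f \<in> F \<Longrightarrow> v \<notin> V \<Longrightarrow>
    stacked (insert v V) (E \<union> (\<lambda>a. {v, a}) ` f) (F - {f} \<union> (\<lambda>a. insert v (f - {a})) ` f)"

lemma stacked_face: "stacked V E F \<Longrightarrow> f \<in> F \<Longrightarrow> f \<subseteq> V \<and> card f = 3"
proof (induction arbitrary: f rule: stacked.induct)
  case (insert V E F g v)
  have g: "g \<subseteq> V" "card g = 3" using insert by auto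
  hence fg: "finite g" by (metis card.infinite zero_neq_numeral)
  show ?case
  proof (cases "f \<in> F")
    case False
    then obtain a where "a \<in> g" "f = insert v (g - {a})" using insert by auto
    thus ?thesis using g fg insert.hyps by (auto simp: card_insert_if)
  qed (use insert in auto)
qed auto

lemma stacked_simple: "stacked V E F \<Longrightarrow> simple_graph V E"
proof (induction rule: stacked.induct)
  case (triangle f)
  hence "finite f" by (metis card.infinite zero_neq_numeral)
  thus ?case by (auto simp: simple_graph_def)
next
  case (insert V E F f v)
  show ?case unfolding simple_graph_def
  proof (intro conjI ballI)
    show "finite (insert v V)" using insert by (auto simp: simple_graph_def)
    fix e assume "e \<in> E \<union> (\<lambda>a. {v, a}) ` f"
    thus "\<exists>u w. u \<noteq> w \<and> u \<in> insert v V \<and> w \<in> insert v V \<and> e = {u, w}"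
    proof
      assume "e \<in> E" thus ?thesis using insert.IH by (fastforce simp: simple_graph_def)
    next
      assume "e \<in> (\<lambda>a. {v, a}) ` f"
      then obtain a where "a \<in> f" "e = {v, a}" by auto
      thus ?thesis using stacked_face[OF insert.hyps(1,2)] insert.hyps(3)
        by (intro exI[of _ v] exI[of _ a]) auto
    qed
  qed
qed

lemma stacked_edge_subset: "stacked V E F \<Longrightarrow> e \<in> E \<Longrightarrow> e \<subseteq> V"
  using stacked_simple unfolding simple_graph_def by fastforce

lemma stacked_finite: "stacked V E F \<Longrightarrow> finite V"
  using stacked_simple unfolding simple_graph_def by auto

section \<open>Connectivity and non-completeness of stacked triangulations\<close>

lemma adj_rel_commute: "(u, v) \<in> (adj_rel V E)\<^sup>* \<Longrightarrow> (v, u) \<in> (adj_rel V E)\<^sup>*"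
proof -
  have "sym (adj_rel V E)" by (auto simp: sym_def adj_rel_def insert_commute)
  thus "(u, v) \<in> (adj_rel V E)\<^sup>* \<Longrightarrow> (v, u) \<in> (adj_rel V E)\<^sup>*"
    using sym_rtrancl symD[of "(adj_rel V E)\<^sup>*" u v] by blast
qed

lemma connected_graph_insert:
  assumes "connected_graph V E" "a \<in> V" "{v, a} \<in> E'" "E \<subseteq> E'"
  shows "connected_graph (insert v V) E'"
proof -
  have mono: "(adj_rel V E)\<^sup>* \<subseteq> (adj_rel (insert v V) E')\<^sup>*"
    by (rule rtrancl_mono) (use assms in \<open>auto simp: adj_rel_def\<close>)
  have to_a: "(u, a) \<in> (adj_rel (insert v V) E')\<^sup>*" if "u \<in> insert v V" for u
  proof (cases "u \<in> V")
    case True thus ?thesis using mono assms by (auto simp: connected_graph_def)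
  next
    case False
    hence "(u, a) \<in> adj_rel (insert v V) E'" using that assms by (auto simp: adj_rel_def)
    thus ?thesis by auto
  qed
  show ?thesis unfolding connected_graph_def
  proof (intro conjI ballI)
    fix u w assume "u \<in> insert v V" "w \<in> insert v V"
    from to_a[OF this(1)] adj_rel_commute[OF to_a[OF this(2)]]
    show "(u, w) \<in> (adj_rel (insert v V) E')\<^sup>*" by (rule rtrancl_trans)
  qed simp
qed

text \<open>If the newest vertex is deleted, the rest is the older graph minus at most one vertex.
  Otherwise one of its three neighbours survives and ties it to the connected remainder.\<close>

lemma stacked_connected:
  "stacked V E F \<Longrightarrow> card S < 3 \<Longrightarrow> finite S \<Longrightarrow> connected_graph (V - S) {e \<in> E. e \<inter> S = {}}"
proof (induction arbitrary: S rule: stacked.induct)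
  case (triangle f)
  let ?E = "{e. (\<exists>u\<in>f. \<exists>v\<in>f. u \<noteq> v \<and> e = {u, v})}"
  have "\<not> f \<subseteq> S" using triangle card_mono[of S f] by auto
  moreover have "(u, v) \<in> (adj_rel (f - S) {e \<in> ?E. e \<inter> S = {}})\<^sup>*" if "u \<in> f - S" "v \<in> f - S" for u v
  proof (cases "u = v")
    case False
    hence "(u, v) \<in> adj_rel (f - S) {e \<in> ?E. e \<inter> S = {}}" using that by (auto simp: adj_rel_def)
    thus ?thesis by auto
  qed auto
  ultimately show ?case unfolding connected_graph_def by auto
next
  case (insert V E F f v)
  let ?E' = "{e \<in> E \<union> (\<lambda>a. {v, a}) ` f. e \<inter> S = {}}"
  have f: "f \<subseteq> V" "card f = 3" using stacked_face[OF insert.hyps(1,2)] by auto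
  show ?case
  proof (cases "v \<in> S")
    case True
    have V: "insert v V - S = V - (S - {v})" using True insert.hyps(3) by auto
    have E: "?E' = {e \<in> E. e \<inter> (S - {v}) = {}}"
      using True insert.hyps(3) stacked_edge_subset[OF insert.hyps(1)] by auto
    have "card (S - {v}) < 3" using insert.prems by (meson card_Diff1_le le_less_trans)
    thus ?thesis unfolding V E using insert.IH insert.prems by simp
  next
    case False
    have "\<not> f \<subseteq> S" using f insert.prems card_mono[of S f] by auto
    then obtain a where a: "a \<in> f" "a \<notin> S" by auto
    have V: "insert v V - S = insert v (V - S)" using False by auto
    show ?thesis unfolding V
      by (rule connected_graph_insert[OF insert.IH[OF insert.prems], of a])
        (use a f False in auto)
  qed
qed

lemma stacked_k_connected:
  assumes "stacked V E F" "3 < card V"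
  shows "k_connected 3 V E"
  unfolding k_connected_def
proof (intro conjI allI impI)
  fix S assume "S \<subseteq> V" "card S < 3"
  thus "connected_graph (V - S) {e \<in> E. e \<inter> S = {}}"
    using stacked_connected[OF assms(1)] finite_subset[OF _ stacked_finite[OF assms(1)]] by blast
qed (fact assms)

text \<open>The vertex inserted last has only three neighbours among at least four older
  vertices.\<close>

lemma stacked_not_complete: "stacked V E F \<Longrightarrow> 5 \<le> card V \<Longrightarrow> \<not> complete_graph V E"
proof (induction rule: stacked.induct)
  case (insert V E F f v)
  have f: "f \<subseteq> V" "card f = 3" using stacked_face[OF insert.hyps(1,2)] by auto
  have fV: "finite V" using stacked_finite[OF insert.hyps(1)] .
  have "card V \<ge> 4" using insert fV by auto
  hence "\<not> V \<subseteq> f" using f card_mono[of f V] finite_subset[OF _ fV] by fastforce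
  then obtain d where d: "d \<in> V" "d \<notin> f" by auto
  have "v \<noteq> d" using d insert.hyps(3) by auto
  have "{v, d} \<notin> E \<union> (\<lambda>a. {v, a}) ` f"
    using d insert.hyps(3) stacked_edge_subset[OF insert.hyps(1), of "{v, d}"]
    by (auto simp: doubleton_eq_iff)
  thus ?case using d \<open>v \<noteq> d\<close> unfolding complete_graph_def by blast
qed simp

section \<open>Straight-line drawings of stacked triangulations\<close>

text \<open>Collects all the geometry of subdividing one triangle, freed from any order of its
  corners: the small triangle opposite the corner \<open>a\<close> is spanned by \<open>m\<close>
  and \<open>X - {a}\<close>.\<close>

lemma centroid_star:
  fixes X :: "complex set"
  assumes X: "card X = 3" "\<not> collinear X"
  obtains m where "m \<in> tri X"
    "\<forall>a\<in>X. convex hull {m, a} \<subseteq> insert a (tri X)"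
    "\<forall>a\<in>X. \<forall>b\<in>X. a \<noteq> b \<longrightarrow> convex hull {m, a} \<inter> convex hull {m, b} \<subseteq> {m}"
    "\<forall>a\<in>X. \<not> collinear (insert m (X - {a}))"
    "\<forall>a\<in>X. tri (insert m (X - {a})) \<subseteq> tri X"
    "\<forall>a\<in>X. \<forall>b\<in>X. tri (insert m (X - {a})) \<inter> convex hull {m, b} = {}"
    "\<forall>a\<in>X. \<forall>b\<in>X. a \<noteq> b \<longrightarrow> tri (insert m (X - {a})) \<inter> tri (insert m (X - {b})) = {}"
proof -
  define m where "m = (1/3) *\<^sub>R (\<Sum>x\<in>X. x)"
  \<comment> \<open>\<open>P\<close> says that \<open>a\<close>, \<open>b\<close>, \<open>c\<close>
    enumerate the corners. Any one or two corners extend to an enumeration, and rotating it brings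
    the lemmas about ordered corners into the right position.\<close>
  define P where "P a b c \<longleftrightarrow> X = {a, b, c} \<and> \<not> collinear {a, b, c} \<and> m = centroid a b c \<and>
      X - {a} = {b, c} \<and> X - {b} = {a, c} \<and> X - {c} = {a, b}" for a b c
  have P: "X = {a, b, c}" "\<not> collinear {a, b, c}" "m = centroid a b c"
      "X - {a} = {b, c}" "X - {b} = {a, c}" "X - {c} = {a, b}" if "P a b c" for a b c
    using that unfolding P_def by auto
  have P_rotate: "P b c a" if "P a b c" for a b c
    using that unfolding P_def by (auto simp: insert_commute centroid_def add_ac)
  have two: "\<exists>c. P a b c" if ab: "a \<in> X" "b \<in> X" "a \<noteq> b" for a b
  proof -
    have "finite X" using X by (metis card.infinite zero_neq_numeral)
    hence "card (X - {a, b}) = 1" using X ab by (simp add: card_Diff_subset)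
    then obtain c where c: "X - {a, b} = {c}" by (meson card_1_singletonE)
    hence *: "X = {a, b, c}" "c \<noteq> a" "c \<noteq> b" using ab by auto
    have "m = centroid a b c"
      using ab * by (simp add: m_def centroid_def scaleR_add_right add.assoc)
    hence "P a b c" using * ab X unfolding P_def by auto
    thus ?thesis ..
  qed
  have one: "\<exists>b c. P a b c" if a: "a \<in> X" for a
  proof -
    have "X \<noteq> {a}" using X by auto
    then obtain b where b: "b \<in> X" "a \<noteq> b" using a by blast
    thus ?thesis using two[OF a] by blast
  qed
  have nc: "\<not> collinear (insert m (X - {a}))" and sub: "tri (insert m (X - {a})) \<subseteq> tri X"
    and opp: "tri (insert m (X - {a})) \<inter> convex hull {m, a} = {}" if "a \<in> X" for a
  proof -
    obtain b c where abc: "P a b c" using one[OF \<open>a \<in> X\<close>] by blast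
    note h = P[OF P_rotate[OF abc]]
    show "\<not> collinear (insert m (X - {a}))"
      using noncollinear_centroid[OF h(2)] h(3,6) by simp
    show "tri (insert m (X - {a})) \<subseteq> tri X"
      using tri_centroid_subset[OF h(2)] unfolding h(6) unfolding h(3) h(1) .
    show "tri (insert m (X - {a})) \<inter> convex hull {m, a} = {}"
      using tri_centroid_Int_spoke[OF h(2)] h(3,6) by simp
  qed
  show ?thesis
  proof (rule that[of m]; (intro ballI impI)?)
    obtain a where "a \<in> X" using X by fastforce
    then obtain b c where abc: "P a b c" using one by blast
    show "m \<in> tri X" using centroid_in[OF P(2)[OF abc]] unfolding P(3)[OF abc] P(1)[OF abc] .
  next
    fix a assume "a \<in> X"
    then obtain b c where abc: "P a b c" using one by blast
    show "convex hull {m, a} \<subseteq> insert a (tri X)"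
      using spoke_subset[OF P(2)[OF abc]] unfolding P(3)[OF abc] P(1)[OF abc] .
  next
    fix a b assume "a \<in> X" "b \<in> X" "a \<noteq> b"
    then obtain c where abc: "P a b c" using two by blast
    show "convex hull {m, a} \<inter> convex hull {m, b} \<subseteq> {m}"
      using side_Int_side[OF noncollinear_centroid[OF P(2)[OF abc]]] unfolding P(3)[OF abc] .
  next
    fix a b assume ab: "a \<in> X" "b \<in> X"
    show "tri (insert m (X - {a})) \<inter> convex hull {m, b} = {}"
    proof (cases "a = b")
      case False
      \<comment> \<open>For distinct \<open>a\<close> and \<open>b\<close> the spoke to
        \<open>b\<close> is a side of the small triangle opposite \<open>a\<close>.\<close>
      then obtain c where "P a b c" using two ab by blast
      hence h: "X - {a} = {b, c}" by (rule P)
      show ?thesis using side_Int_tri[of m b c] nc[OF ab(1)] unfolding h by auto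
    qed (use opp ab in simp)
  next
    fix a b assume "a \<in> X" "b \<in> X" "a \<noteq> b"
    then obtain c where abc: "P a b c" using two by blast
    note h = P[OF P_rotate[OF P_rotate[OF abc]]]
    show "tri (insert m (X - {a})) \<inter> tri (insert m (X - {b})) = {}"
      using tri_centroid_disjoint[OF h(2)] unfolding h(5,6) unfolding h(3) by auto
  qed (fact nc sub)+
qed

text \<open>Planarity with straight edges, strengthened for induction: the open faces are
  nondegenerate, avoid all vertices and edges, and are pairwise disjoint.\<close>

definition drawing :: "nat set \<Rightarrow> nat set set \<Rightarrow> nat set set \<Rightarrow> (nat \<Rightarrow> complex) \<Rightarrow> bool" where
  "drawing V E F p \<longleftrightarrow> inj_on p V \<and>
     (\<forall>e\<in>E. \<forall>v\<in>V. p v \<in> convex hull (p ` e) \<longrightarrow> v \<in> e) \<and>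
     (\<forall>e\<in>E. \<forall>e'\<in>E. e \<noteq> e' \<longrightarrow> convex hull (p ` e) \<inter> convex hull (p ` e') \<subseteq> p ` (e \<inter> e')) \<and>
     (\<forall>f\<in>F. \<not> collinear (p ` f) \<and> tri (p ` f) \<inter> p ` V = {} \<and>
        (\<forall>e\<in>E. tri (p ` f) \<inter> convex hull (p ` e) = {})) \<and>
     (\<forall>f\<in>F. \<forall>f'\<in>F. f \<noteq> f' \<longrightarrow> tri (p ` f) \<inter> tri (p ` f') = {})"

text \<open>The new vertex goes to the centroid of the face. Apart from the far ends of the spokes,
  everything new lies in the open face, which meets nothing old.\<close>

lemma drawing_insert:
  assumes d: "drawing V E F p" and st: "stacked V E F" and f: "f \<in> F" and v: "v \<notin> V"
  shows "\<exists>q. drawing (insert v V) (E \<union> (\<lambda>a. {v, a}) ` f) (F - {f} \<union> (\<lambda>a. insert v (f - {a})) ` f) q"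
proof -
  have inj: "inj_on p V" and
    d1: "\<forall>e\<in>E. \<forall>v\<in>V. p v \<in> convex hull (p ` e) \<longrightarrow> v \<in> e" and
    d2: "\<forall>e\<in>E. \<forall>e'\<in>E. e \<noteq> e' \<longrightarrow> convex hull (p ` e) \<inter> convex hull (p ` e') \<subseteq> p ` (e \<inter> e')" and
    d3: "\<forall>f\<in>F. \<not> collinear (p ` f) \<and> tri (p ` f) \<inter> p ` V = {} \<and>
        (\<forall>e\<in>E. tri (p ` f) \<inter> convex hull (p ` e) = {})" and
    d4: "\<forall>f\<in>F. \<forall>f'\<in>F. f \<noteq> f' \<longrightarrow> tri (p ` f) \<inter> tri (p ` f') = {}"
    using d unfolding drawing_def by - (elim conjE, assumption)+
  note EV = d1[rule_format] and EE = d2[rule_format] and FF = d4[rule_format]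
    and nc = d3[rule_format, THEN conjunct1]
    and FV = d3[rule_format, THEN conjunct2, THEN conjunct1]
    and FE = d3[rule_format, THEN conjunct2, THEN conjunct2, THEN bspec]
  have face: "g \<subseteq> V" "card g = 3" if "g \<in> F" for g using stacked_face[OF st that] by auto
  have edge: "e \<subseteq> V" if "e \<in> E" for e using stacked_edge_subset[OF st that] .
  have injf: "inj_on p f" using inj face[OF f] inj_on_subset by blast
  have card: "card (p ` f) = 3" using card_image[OF injf] face[OF f] by simp
  obtain m where ms: "m \<in> tri (p ` f)"
    "\<forall>a\<in>p ` f. convex hull {m, a} \<subseteq> insert a (tri (p ` f))"
    "\<forall>a\<in>p ` f. \<forall>b\<in>p ` f. a \<noteq> b \<longrightarrow> convex hull {m, a} \<inter> convex hull {m, b} \<subseteq> {m}"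
    "\<forall>a\<in>p ` f. \<not> collinear (insert m (p ` f - {a}))"
    "\<forall>a\<in>p ` f. tri (insert m (p ` f - {a})) \<subseteq> tri (p ` f)"
    "\<forall>a\<in>p ` f. \<forall>b\<in>p ` f. tri (insert m (p ` f - {a})) \<inter> convex hull {m, b} = {}"
    "\<forall>a\<in>p ` f. \<forall>b\<in>p ` f. a \<noteq> b \<longrightarrow>
       tri (insert m (p ` f - {a})) \<inter> tri (insert m (p ` f - {b})) = {}"
    by (rule centroid_star[OF card nc[OF f]]) (rule that; assumption)
  note m = ms[rule_format]
  define q where "q = p(v := m)"
  have qv: "q v = m" by (simp add: q_def)
  have qV: "q u = p u" if "u \<in> V" for u using that v by (auto simp: q_def)
  have qs: "q ` s = p ` s" if "s \<subseteq> V" for s using that qV by (intro image_cong) auto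
  have q_new_edge: "q ` {v, a} = {m, p a}" if "a \<in> f" for a
    using that face[OF f] qv qV by auto
  have q_new_face: "q ` insert v (f - {a}) = insert m (p ` f - {p a})" if "a \<in> f" for a
  proof -
    have "p ` (f - {a}) = p ` f - {p a}" using that injf by (auto simp: inj_on_def)
    thus ?thesis using qs[of "f - {a}"] face[OF f] qv by auto
  qed
  have mV: "m \<notin> p ` V" using FV[OF f] m(1) by auto
  have pf: "p a \<in> p ` f" if "a \<in> f" for a using that by simp
  \<comment> \<open>The next three facts say that a spoke can meet old vertices and edges only at
    its corner \<open>p a\<close>, and meets no other open face.\<close>
  have spokeV: "u = a" if "a \<in> f" "u \<in> V" "p u \<in> convex hull {m, p a}" for a u
  proof -
    have "p u = p a" using m(2)[OF pf[OF that(1)]] that FV[OF f] by auto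
    thus ?thesis using inj that face[OF f] by (auto dest: inj_onD)
  qed
  have spokeE: "convex hull (p ` e) \<inter> convex hull {m, p a} \<subseteq> p ` (e \<inter> {a})" if "a \<in> f" "e \<in> E" for a e
  proof
    fix x assume x: "x \<in> convex hull (p ` e) \<inter> convex hull {m, p a}"
    hence "x = p a" using m(2)[OF pf[OF that(1)]] FE[OF f that(2)] by auto
    moreover have "a \<in> e" using EV[OF that(2), of a] x \<open>x = p a\<close> face[OF f] that by auto
    ultimately show "x \<in> p ` (e \<inter> {a})" by auto
  qed
  have spokeF: "tri (p ` g) \<inter> convex hull {m, p a} = {}" if "a \<in> f" "g \<in> F" "g \<noteq> f" for a g
    using m(2)[OF pf[OF that(1)]] FF[OF that(2) f that(3)] FV[OF that(2)] face[OF f] that(1) by blast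
  let ?E = "E \<union> (\<lambda>a. {v, a}) ` f" and ?F = "F - {f} \<union> (\<lambda>a. insert v (f - {a})) ` f"
  have "drawing (insert v V) ?E ?F q"
    unfolding drawing_def
  proof (intro conjI ballI impI)
    show "inj_on q (insert v V)"
      using inj mV qs[of V] v inj_on_cong[of V q p] by (simp add: qv qV)
  next
    fix e u assume e: "e \<in> ?E" and u: "u \<in> insert v V" and h: "q u \<in> convex hull (q ` e)"
    from e show "u \<in> e"
    proof
      assume e: "e \<in> E"
      have h': "q u \<in> convex hull (p ` e)" using h qs[OF edge[OF e]] by simp
      hence "u \<noteq> v" using FE[OF f e] m(1) qv by auto
      thus ?thesis using u h' EV[OF e] qV by auto
    next
      assume "e \<in> (\<lambda>a. {v, a}) ` f"
      then obtain a where a: "a \<in> f" "e = {v, a}" by auto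
      show ?thesis
      proof (cases "u = v")
        case False
        hence "u \<in> V" using u by auto
        hence "u = a" using spokeV[OF a(1)] h q_new_edge[OF a(1)] a(2) qV by simp
        thus ?thesis using a by simp
      qed (use a in simp)
    qed
  next
    fix e e' assume e: "e \<in> ?E" and e': "e' \<in> ?E" and ne: "e \<noteq> e'"
    have old_new: "convex hull (q ` e) \<inter> convex hull (q ` {v, a}) \<subseteq> q ` (e \<inter> {v, a})"
      if "e \<in> E" "a \<in> f" for e a
    proof -
      have "e \<inter> {v, a} = e \<inter> {a}" using edge[OF that(1)] v by auto
      moreover have "q ` (e \<inter> {a}) = p ` (e \<inter> {a})" using edge[OF that(1)] by (intro qs) auto
      ultimately show ?thesis
        using spokeE[OF that(2,1)] qs[OF edge[OF that(1)]] q_new_edge[OF that(2)] by simp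
    qed
    from e e' show "convex hull (q ` e) \<inter> convex hull (q ` e') \<subseteq> q ` (e \<inter> e')"
    proof (elim UnE imageE)
      assume ee: "e \<in> E" "e' \<in> E"
      have "q ` (e \<inter> e') = p ` (e \<inter> e')" using edge[OF ee(1)] by (intro qs) auto
      thus ?thesis using EE[OF ee ne] qs[OF edge[OF ee(1)]] qs[OF edge[OF ee(2)]] by simp
    next
      fix a assume "e \<in> E" "e' = {v, a}" "a \<in> f"
      thus ?thesis using old_new by simp
    next
      fix a assume "e = {v, a}" "e' \<in> E" "a \<in> f"
      thus ?thesis using old_new[of e' a] by (simp only: Int_commute)
    next
      fix a b assume ab: "e = {v, a}" "a \<in> f" "e' = {v, b}" "b \<in> f"
      have "p a \<noteq> p b" using ab ne injf by (auto dest: inj_onD)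
      hence "convex hull (q ` e) \<inter> convex hull (q ` e') \<subseteq> {m}"
        using m(3)[OF pf[OF ab(2)] pf[OF ab(4)]] q_new_edge[OF ab(2)] q_new_edge[OF ab(4)] ab by simp
      thus ?thesis using ab qv by auto
    qed
  next
    fix g assume g: "g \<in> ?F"
    from g show "\<not> collinear (q ` g)"
    proof (elim UnE imageE)
      assume "g \<in> F - {f}"
      thus ?thesis using nc qs face by simp
    next
      fix a assume "g = insert v (f - {a})" "a \<in> f"
      thus ?thesis using m(4)[OF pf] q_new_face by simp
    qed
    from g show "tri (q ` g) \<inter> q ` insert v V = {}"
    proof (elim UnE imageE)
      assume "g \<in> F - {f}"
      hence "tri (p ` g) \<inter> p ` V = {}" "m \<notin> tri (p ` g)" "q ` g = p ` g"
        using FV[of g] FF[of g f] f m(1) qs[of g] face[of g] by auto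
      moreover have "q ` insert v V = insert m (p ` V)" using qs[of V] qv by simp
      ultimately show ?thesis by simp
    next
      fix a assume a: "g = insert v (f - {a})" "a \<in> f"
      \<comment> \<open>\<open>m\<close> is an end of every spoke, and the small open triangles
        avoid the spokes.\<close>
      have "m \<notin> tri (q ` g)" using m(6)[OF pf[OF a(2)] pf[OF a(2)]] q_new_face[OF a(2)] a(1)
        hull_inc[of m "{m, p a}"] by auto
      moreover have "tri (q ` g) \<subseteq> tri (p ` f)" using m(5)[OF pf[OF a(2)]] q_new_face[OF a(2)] a(1) by simp
      ultimately show ?thesis using FV[OF f] qs[of V] qv by auto
    qed
    fix e assume e: "e \<in> ?E"
    from g e show "tri (q ` g) \<inter> convex hull (q ` e) = {}"
    proof (elim UnE imageE)
      assume "g \<in> F - {f}" "e \<in> E"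
      thus ?thesis using FE qs[of g] qs[of e] face edge by simp
    next
      fix a assume "g \<in> F - {f}" "e = {v, a}" "a \<in> f"
      thus ?thesis using spokeF qs[of g] q_new_edge face by simp
    next
      fix a assume a: "g = insert v (f - {a})" "a \<in> f" "e \<in> E"
      have "tri (q ` g) \<subseteq> tri (p ` f)" using m(5)[OF pf[OF a(2)]] q_new_face[OF a(2)] a(1) by simp
      thus ?thesis using FE[OF f a(3)] qs[OF edge[OF a(3)]] by auto
    next
      fix a b assume "g = insert v (f - {a})" "a \<in> f" "e = {v, b}" "b \<in> f"
      thus ?thesis using m(6)[OF pf pf] q_new_face q_new_edge by simp
    qed
  next
    fix g h assume g: "g \<in> ?F" and h: "h \<in> ?F" and ne: "g \<noteq> h"
    have old_new: "tri (q ` g) \<inter> tri (q ` insert v (f - {a})) = {}" if "g \<in> F - {f}" "a \<in> f" for g a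
      using m(5)[OF pf[OF that(2)]] q_new_face[OF that(2)] FF[of g f] f qs[of g] face[of g] that(1)
      by auto
    from g h show "tri (q ` g) \<inter> tri (q ` h) = {}"
    proof (elim UnE imageE)
      assume "g \<in> F - {f}" "h \<in> F - {f}"
      thus ?thesis using FF[of g h] ne qs[of g] qs[of h] face by simp
    next
      fix a assume "g \<in> F - {f}" "h = insert v (f - {a})" "a \<in> f"
      thus ?thesis using old_new by simp
    next
      fix a assume "g = insert v (f - {a})" "a \<in> f" "h \<in> F - {f}"
      thus ?thesis using old_new[of h a] by (simp only: Int_commute)
    next
      fix a b assume ab: "g = insert v (f - {a})" "a \<in> f" "h = insert v (f - {b})" "b \<in> f"
      have "p a \<noteq> p b" using ab ne injf by (auto dest: inj_onD)
      thus ?thesis using m(7)[OF pf[OF ab(2)] pf[OF ab(4)]]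
          q_new_face[OF ab(2)] q_new_face[OF ab(4)] ab by simp
    qed
  qed
  thus ?thesis by blast
qed

lemma drawing_triangle:
  assumes "card f = 3"
  shows "\<exists>p. drawing f {e. \<exists>u\<in>f. \<exists>v\<in>f. u \<noteq> v \<and> e = {u, v}} {f} p"
proof -
  obtain a b c where abc: "f = {a, b, c}" "a \<noteq> b" "a \<noteq> c" "b \<noteq> c"
    using assms by (metis card_3_iff)
  define p where "p = (\<lambda>v. if v = a then 0 else if v = b then 1 else \<i>)"
  have p: "p a = 0" "p b = 1" "p c = \<i>" using abc by (auto simp: p_def)
  have "\<not> (\<exists>r. \<i> = r *\<^sub>R (1::complex))" by (auto simp: complex_eq_iff)
  hence "\<not> collinear {0, 1, \<i>}" unfolding collinear_lemma by auto
  hence pf: "\<not> collinear (p ` f)" using abc(1) p by simp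
  have nc: "\<not> collinear {p u, p v, p w}" if "{u, v, w} = f" for u v w
    using pf unfolding that[symmetric] by simp
  have inj: "inj_on p f" using abc p by (auto simp: inj_on_def)
  have third: "\<exists>w. {u, v, w} = f" if "u \<in> f" "v \<in> f" "u \<noteq> v" for u v
    using that unfolding abc(1) by auto
  show ?thesis
  proof (rule exI[of _ p], unfold drawing_def, intro conjI ballI impI)
    fix e v assume "e \<in> {e. \<exists>u\<in>f. \<exists>v\<in>f. u \<noteq> v \<and> e = {u, v}}" and v: "v \<in> f"
      and h: "p v \<in> convex hull (p ` e)"
    then obtain x y where xy: "x \<in> f" "y \<in> f" "x \<noteq> y" "e = {x, y}" by auto
    obtain z where z: "{x, y, z} = f" using third[OF xy(1-3)] by blast
    have "p z \<notin> convex hull (p ` e)" using opposite_notin_side[OF nc[OF z]] xy(4) by simp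
    thus "v \<in> e" using h v z xy(4) by auto
  next
    fix e e' assume "e \<in> {e. \<exists>u\<in>f. \<exists>v\<in>f. u \<noteq> v \<and> e = {u, v}}"
      "e' \<in> {e. \<exists>u\<in>f. \<exists>v\<in>f. u \<noteq> v \<and> e = {u, v}}" and ne: "e \<noteq> e'"
    then obtain x y x' y' where xy: "x \<in> f" "y \<in> f" "x \<noteq> y" "e = {x, y}"
      "x' \<in> f" "y' \<in> f" "x' \<noteq> y'" "e' = {x', y'}" by auto
    obtain z where z: "{x, y, z} = f" using third[OF xy(1-3)] by blast
    \<comment> \<open>Two different sides of a triangle share a corner; the corners are renamed so
      that it comes first.\<close>
    hence "e' = {x, z} \<or> e' = {y, z}" using xy ne by auto
    hence "\<exists>u v w. {u, v, w} = f \<and> e = {u, v} \<and> e' = {u, w}"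
    proof
      assume "e' = {x, z}" thus ?thesis using z xy(4) by blast
    next
      assume "e' = {y, z}"
      moreover have "{y, x, z} = f" "e = {y, x}" using z xy(4) by auto
      ultimately show ?thesis by blast
    qed
    then obtain u v w where u: "{u, v, w} = f" "e = {u, v}" "e' = {u, w}" by blast
    show "convex hull (p ` e) \<inter> convex hull (p ` e') \<subseteq> p ` (e \<inter> e')"
      using side_Int_side[OF nc[OF u(1)]] u(2,3) by auto
  next
    fix g e assume "g \<in> {f}" and "e \<in> {e. \<exists>u\<in>f. \<exists>v\<in>f. u \<noteq> v \<and> e = {u, v}}"
    then obtain x y where xy: "x \<in> f" "y \<in> f" "x \<noteq> y" "e = {x, y}" "g = f" by auto
    obtain z where z: "{x, y, z} = f" using third[OF xy(1-3)] by blast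
    show "tri (p ` g) \<inter> convex hull (p ` e) = {}"
      using side_Int_tri[OF nc[OF z]] xy(4,5) unfolding z[symmetric] by auto
  next
    fix g assume "g \<in> {f}"
    hence g: "g = f" by simp
    show "\<not> collinear (p ` g)" using nc[of a b c] abc g by simp
    have "p v \<notin> tri (p ` f)" if v: "v \<in> f" for v
    proof -
      obtain u where u: "u \<in> f" "v \<noteq> u" using abc by auto
      obtain w where w: "{v, u, w} = f" using third[OF v u] by blast
      have "p v \<in> convex hull {p v, p u}" by (simp add: hull_inc)
      thus ?thesis using side_Int_tri[OF nc[OF w]] w by auto
    qed
    thus "tri (p ` g) \<inter> p ` f = {}" using g by auto
  qed (use inj in auto)
qed

section \<open>Planarity of stacked triangulations\<close>

lemma stacked_drawing: "stacked V E F \<Longrightarrow> \<exists>p. drawing V E F p"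
proof (induction rule: stacked.induct)
  case (insert V E F f v)
  thus ?case using drawing_insert by blast
qed (rule drawing_triangle)

lemma drawing_planar:
  assumes "drawing V E F p" "simple_graph V E"
  shows "planar V E"
proof -
  have inj: "inj_on p V" and
    d1: "\<forall>e\<in>E. \<forall>v\<in>V. p v \<in> convex hull (p ` e) \<longrightarrow> v \<in> e" and
    d2: "\<forall>e\<in>E. \<forall>e'\<in>E. e \<noteq> e' \<longrightarrow> convex hull (p ` e) \<inter> convex hull (p ` e') \<subseteq> p ` (e \<inter> e')"
    using assms(1) unfolding drawing_def by - (elim conjE, assumption)+
  have "\<exists>g. arc g \<and> {pathstart g, pathfinish g} = p ` e \<and> path_image g = convex hull (p ` e)"
    if "e \<in> E" for e
  proof -
    have "\<exists>u v. u \<noteq> v \<and> u \<in> V \<and> v \<in> V \<and> e = {u, v}"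
      by (rule bspec[OF conjunct2[OF assms(2)[unfolded simple_graph_def]] that])
    then obtain u v where uv: "u \<noteq> v" "u \<in> V" "v \<in> V" "e = {u, v}" by (elim exE conjE)
    hence "p u \<noteq> p v" using inj by (auto dest: inj_onD)
    thus ?thesis using uv
      by (intro exI[of _ "linepath (p u) (p v)"]) (simp add: segment_convex_hull)
  qed
  hence "\<forall>e\<in>E. \<exists>g. arc g \<and> {pathstart g, pathfinish g} = p ` e \<and> path_image g = convex hull (p ` e)"
    \<comment> \<open>An edge is an unordered pair, so the orientation of its segment has to be
      chosen; this is done for all edges at once.\<close>
    by (rule ballI)
  from bchoice[OF this] obtain \<gamma> where g: "\<forall>e\<in>E. arc (\<gamma> e) \<and>
      {pathstart (\<gamma> e), pathfinish (\<gamma> e)} = p ` e \<and> path_image (\<gamma> e) = convex hull (p ` e)" ..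
  have img: "path_image (\<gamma> e) = convex hull (p ` e)" if "e \<in> E" for e using g that by blast
  show ?thesis unfolding planar_def
  proof (intro exI[of _ p] exI[of _ \<gamma>] conjI ballI impI)
    fix e e' assume e: "e \<in> E" "e' \<in> E" "e \<noteq> e'"
    show "path_image (\<gamma> e) \<inter> path_image (\<gamma> e') \<subseteq> p ` (e \<inter> e')"
      unfolding img[OF e(1)] img[OF e(2)] by (rule d2[rule_format, OF e])
  next
    fix e v assume e: "e \<in> E" "v \<in> V" "p v \<in> path_image (\<gamma> e)"
    show "v \<in> e" using d1[rule_format, OF e(1,2)] e(3) unfolding img[OF e(1)] .
  qed (use inj g in blast)+
qed

section \<open>List assignments and the gadget\<close>

lemma stacked_insert:
  assumes st: "stacked V E F" and f: "{a, b, c} \<in> F" and v: "v \<notin> V"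
  obtains F' where "stacked (insert v V) (E \<union> {{v, a}, {v, b}, {v, c}}) F'"
    "F - {{a, b, c}} \<subseteq> F'" "{v, b, c} \<in> F'" "{v, a, c} \<in> F'" "{v, a, b} \<in> F'"
proof -
  have d: "a \<noteq> b" "a \<noteq> c" "b \<noteq> c"
    using stacked_face[OF st f] by (auto simp: card_insert_if split: if_splits)
  have *: "(\<lambda>a. {v, a}) ` {a, b, c} = {{v, a}, {v, b}, {v, c}}"
    "(\<lambda>x. insert v ({a, b, c} - {x})) ` {a, b, c} = {{v, b, c}, {v, a, c}, {v, a, b}}"
    using d by auto
  show ?thesis
    by (rule that[OF stacked.insert[OF st f v, unfolded *]]) auto
qed

text \<open>A list of possible neighbours gives a bound that evaluates by simplification, without
  comparing its entries.\<close>

lemma degree_le_length: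
  assumes "\<And>u. {u, v} \<in> E \<Longrightarrow> u \<in> set xs"
  shows "degree V E v \<le> length xs"
proof -
  have "degree V E v \<le> card (set xs)" unfolding degree_def by (rule card_mono) (use assms in auto)
  thus ?thesis using card_length[of xs] by simp
qed

text \<open>The invariant of the construction: at every stage the lists are admissible for the
  current degrees, truncated at 8.\<close>

definition config :: "nat set \<Rightarrow> nat set set \<Rightarrow> nat set set \<Rightarrow> (nat \<Rightarrow> nat set) \<Rightarrow> bool" where
  "config V E F L \<longleftrightarrow> stacked V E F \<and> f_list_assignment V (\<lambda>v. min 8 (degree V E v)) L"

definition extends :: "nat set \<Rightarrow> nat set set \<Rightarrow> (nat \<Rightarrow> nat set) \<Rightarrow>
    nat set \<Rightarrow> nat set set \<Rightarrow> (nat \<Rightarrow> nat set) \<Rightarrow> bool" where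
  "extends V E L V' E' L' \<longleftrightarrow> V \<subseteq> V' \<and> E \<subseteq> E' \<and> (\<forall>v\<in>V. L' v = L v)"

lemma extends_trans: "extends V E L V' E' L' \<Longrightarrow> extends V' E' L' V'' E'' L'' \<Longrightarrow> extends V E L V'' E'' L''"
  unfolding extends_def by auto

text \<open>Consequently a colouring pattern that has been forbidden once stays forbidden in every
  extension.\<close>

lemma extends_colouring: "extends V E L V' E' L' \<Longrightarrow> L_colouring V' E' L' \<phi> \<Longrightarrow> L_colouring V E L \<phi>"
  unfolding extends_def L_colouring_def by (metis subsetD)

lemma config_face:
  assumes "config V E F L" "{a, b, c} \<in> F"
  shows "a \<in> V" "b \<in> V" "c \<in> V" "a \<noteq> b" "a \<noteq> c" "b \<noteq> c"
  using assms stacked_face[of V E F "{a, b, c}"]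
  by (auto simp: config_def card_insert_if split: if_splits)

text \<open>Only the corners of the face gain degree, and their lists of size at least 8 meet the
  truncated demand whatever the degree. The new vertex gets 8 colours and can serve as such a corner
  later.\<close>

lemma config_insert:
  assumes cf: "config V E F L" and f: "{a, b, c} \<in> F" and v: "v \<notin> V"
    and big: "8 \<le> card (L a)" "8 \<le> card (L b)" "8 \<le> card (L c)" and C: "card C = 8"
  obtains F' where "config (insert v V) (E \<union> {{v, a}, {v, b}, {v, c}}) F' (L(v := C))"
    "extends V E L (insert v V) (E \<union> {{v, a}, {v, b}, {v, c}}) (L(v := C))"
    "F - {{a, b, c}} \<subseteq> F'" "{v, b, c} \<in> F'" "{v, a, c} \<in> F'" "{v, a, b} \<in> F'"
proof -
  have st: "stacked V E F" and la: "f_list_assignment V (\<lambda>v. min 8 (degree V E v)) L"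
    using cf by (auto simp: config_def)
  let ?E = "E \<union> {{v, a}, {v, b}, {v, c}}"
  have "f_list_assignment (insert v V) (\<lambda>u. min 8 (degree (insert v V) ?E u)) (L(v := C))"
    unfolding f_list_assignment_def
  proof (intro ballI conjI)
    fix u assume u: "u \<in> insert v V"
    have "finite C" using C by (metis card.infinite zero_neq_numeral)
    thus "finite ((L(v := C)) u)" using la u by (auto simp: f_list_assignment_def)
    show "min 8 (degree (insert v V) ?E u) \<le> card ((L(v := C)) u)"
    proof (cases "u \<in> {v, a, b, c}")
      case True
      thus ?thesis using big C by auto
    next
      case False
      have "degree (insert v V) ?E u = degree V E u" unfolding degree_def
        using False v stacked_edge_subset[OF st]
        by (intro arg_cong[of _ _ card]) (auto simp: doubleton_eq_iff)
      thus ?thesis using la u False by (auto simp: f_list_assignment_def)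
    qed
  qed
  moreover have "extends V E L (insert v V) ?E (L(v := C))" using v by (auto simp: extends_def)
  ultimately show ?thesis
    by - (rule stacked_insert[OF st f v], rule that, auto simp: config_def)
qed

lemma small_list_collision:
  assumes "card A = 3" "{a, b, c, d} \<subseteq> A" "distinct [a, b, c, d]"
  shows False
proof -
  have "finite A" using assms(1) by (metis card.infinite zero_neq_numeral)
  thus False using card_mono[OF _ assms(2)] assms(1,3) by auto
qed

text \<open>The inserted vertices are \<open>x\<close> in the face \<open>pzt\<close>, \<open>v\<close> in \<open>xpz\<close>, \<open>w\<close> in \<open>vxz\<close>, and symmetrically \<open>v'\<close> in
  \<open>xpt\<close>, \<open>w'\<close> in \<open>v'xt\<close>. If \<open>x\<close> gets a colour from \<open>A\<close>, then the pairwise adjacent vertices \<open>x\<close>, \<open>v\<close>, \<open>w\<close>,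
  \<open>z\<close> all have colours from the 3-set \<open>A\<close>.\<close>

lemma gadget:
  assumes cf: "config V E F L" and f: "{p, z, t} \<in> F"
    and big: "8 \<le> card (L p)" "8 \<le> card (L z)" "8 \<le> card (L t)"
    and A: "card A = 3" and B: "card B = 3" and AB: "A \<inter> B = {}" "\<alpha> \<notin> A" "\<alpha> \<notin> B"
  obtains V' E' F' L' where "config V' E' F' L'" "extends V E L V' E' L'" "F - {{p, z, t}} \<subseteq> F'"
    "\<forall>\<phi>. L_colouring V' E' L' \<phi> \<longrightarrow> \<not> (\<phi> p = \<alpha> \<and> \<phi> z \<in> A \<and> \<phi> t \<in> B)"
proof -
  have st: "stacked V E F" and la: "f_list_assignment V (\<lambda>v. min 8 (degree V E v)) L"
    using cf by (auto simp: config_def)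
  note pzt = config_face[OF cf f]
  have finA: "finite A" "finite B" using A B by (metis card.infinite zero_neq_numeral)+
  obtain n where n: "\<forall>u\<in>V. u < n" using stacked_finite[OF st] by (meson finite_nat_set_iff_bounded)
  obtain x v w v' w' where fresh: "x \<notin> V" "v \<notin> V" "w \<notin> V" "v' \<notin> V" "w' \<notin> V"
    and dist: "distinct [x, v, w, v', w']"
  proof (rule that[of n "n + 1" "n + 2" "n + 3" "n + 4"])
  qed (use n in auto)
  have ne: "u \<noteq> x" "u \<noteq> v" "u \<noteq> w" "u \<noteq> v'" "u \<noteq> w'" if "u \<in> V" for u using that fresh by auto
  note ne' = ne[OF pzt(1)] ne[OF pzt(2)] ne[OF pzt(3)]
  have d: "x \<noteq> v" "x \<noteq> w" "x \<noteq> v'" "x \<noteq> w'" "v \<noteq> w" "v \<noteq> v'" "v \<noteq> w'" "w \<noteq> v'" "w \<noteq> w'" "v' \<noteq> w'"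
    using dist by auto
  obtain F1 where F1: "stacked (insert x V) (E \<union> {{x, p}, {x, z}, {x, t}}) F1"
    "F - {{p, z, t}} \<subseteq> F1" "{x, p, t} \<in> F1" "{x, p, z} \<in> F1"
    by (rule stacked_insert[OF st f fresh(1)]) (rule that; assumption)
  have 2: "v \<notin> insert x V" using fresh d by auto
  obtain F2 where F2: "stacked (insert v (insert x V)) (E \<union> {{x, p}, {x, z}, {x, t}}
      \<union> {{v, x}, {v, p}, {v, z}}) F2" "F1 - {{x, p, z}} \<subseteq> F2" "{v, x, z} \<in> F2"
    by (rule stacked_insert[OF F1(1,4) 2]) (rule that; assumption)
  have 3: "w \<notin> insert v (insert x V)" using fresh d by auto
  obtain F3 where F3: "stacked (insert w (insert v (insert x V))) (E \<union> {{x, p}, {x, z}, {x, t}}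
      \<union> {{v, x}, {v, p}, {v, z}} \<union> {{w, v}, {w, x}, {w, z}}) F3" "F2 - {{v, x, z}} \<subseteq> F3"
    by (rule stacked_insert[OF F2(1,3) 3]) (rule that; assumption)
  \<comment> \<open>The face for the second half of the gadget must survive the two insertions on
    the side of \<open>z\<close>.\<close>
  have "{x, p, t} \<noteq> {x, p, z}" "{x, p, t} \<noteq> {v, x, z}" using pzt d ne' by auto
  hence f3: "{x, p, t} \<in> F3" using F1(3) F2(2) F3(2) by blast
  have 4: "v' \<notin> insert w (insert v (insert x V))" using fresh d by auto
  obtain F4 where F4: "stacked (insert v' (insert w (insert v (insert x V)))) (E \<union> {{x, p}, {x, z}, {x, t}}
      \<union> {{v, x}, {v, p}, {v, z}} \<union> {{w, v}, {w, x}, {w, z}} \<union> {{v', x}, {v', p}, {v', t}}) F4"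
    "F3 - {{x, p, t}} \<subseteq> F4" "{v', x, t} \<in> F4"
    by (rule stacked_insert[OF F3(1) f3 4]) (rule that; assumption)
  have 5: "w' \<notin> insert v' (insert w (insert v (insert x V)))" using fresh d by auto
  define V5 where "V5 = insert w' (insert v' (insert w (insert v (insert x V))))"
  define E5 where "E5 = E \<union> {{x, p}, {x, z}, {x, t}} \<union> {{v, x}, {v, p}, {v, z}}
    \<union> {{w, v}, {w, x}, {w, z}} \<union> {{v', x}, {v', p}, {v', t}} \<union> {{w', v'}, {w', x}, {w', t}}"
  obtain F5 where F5: "stacked V5 E5 F5" "F4 - {{v', x, t}} \<subseteq> F5"
    by (rule stacked_insert[OF F4(1,3) 5, folded V5_def E5_def]) (rule that; assumption)
  \<comment> \<open>All faces used up after the first insertion contain \<open>x\<close>, so none of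
    them is a face of \<open>F\<close>.\<close>
  have "x \<notin> g" if "g \<in> F" for g using stacked_face[OF st that] fresh by auto
  hence faces: "F - {{p, z, t}} \<subseteq> F5" using F1(2) F2(2) F3(2) F4(2) F5(2) by blast
  have E: "u \<in> V" "y \<in> V" if "{u, y} \<in> E" for u y using stacked_edge_subset[OF st that] by auto
  have noE: "{y, u} \<notin> E" "{u, y} \<notin> E" if "u \<in> {x, v, w, v', w'}" for u y
    using E[of u y] E[of y u] that fresh by auto
  define L5 where "L5 = L(x := insert \<alpha> (A \<union> B), v := insert \<alpha> A, w := A, v' := insert \<alpha> B, w' := B)"
  have L5: "L5 x = insert \<alpha> (A \<union> B)" "L5 v = insert \<alpha> A" "L5 w = A" "L5 v' = insert \<alpha> B" "L5 w' = B"
    using d by (auto simp: L5_def)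
  have L5V: "L5 u = L u" if "u \<in> V" for u using ne[OF that] by (simp add: L5_def)
  have card5: "card (L5 x) = 7" "card (L5 v) = 4" "card (L5 w) = 3" "card (L5 v') = 4" "card (L5 w') = 3"
    using finA A B AB by (auto simp: L5 card_Un_disjoint)
  \<comment> \<open>The list sizes 7, 4, 3, 4, 3 match these neighbour counts exactly; all are below
    8, so lists as small as the degree are allowed here.\<close>
  have deg: "degree V5 E5 x \<le> length [p, z, t, v, w, v', w']" "degree V5 E5 v \<le> length [x, p, z, w]"
    "degree V5 E5 w \<le> length [v, x, z]" "degree V5 E5 v' \<le> length [x, p, t, w']"
    "degree V5 E5 w' \<le> length [v', x, t]"
    by (rule degree_le_length, use d ne' in \<open>force simp: E5_def noE doubleton_eq_iff\<close>)+
  have "f_list_assignment V5 (\<lambda>u. min 8 (degree V5 E5 u)) L5"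
    unfolding f_list_assignment_def
  proof (intro ballI conjI)
    fix u assume u: "u \<in> V5"
    show "finite (L5 u)" using la u finA by (auto simp: f_list_assignment_def L5_def V5_def)
    consider "u \<in> {x, v, w, v', w'}" | "u \<in> {p, z, t}" | "u \<in> V" "u \<notin> {p, z, t}"
      using u by (auto simp: V5_def)
    thus "min 8 (degree V5 E5 u) \<le> card (L5 u)"
    proof cases
      case 1
      thus ?thesis using deg card5 by auto
    next
      case 2
      thus ?thesis using big pzt L5V by auto
    next
      case 3
      have "degree V5 E5 u = degree V E u" unfolding degree_def
        using 3 ne[OF 3(1)] E
        by (intro arg_cong[of _ _ card]) (auto simp: E5_def V5_def doubleton_eq_iff)
      thus ?thesis using la 3(1) L5V by (simp add: f_list_assignment_def)
    qed
  qed
  hence cf5: "config V5 E5 F5 L5" using F5(1) by (simp add: config_def)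
  have ext: "extends V E L V5 E5 L5" using L5V by (auto simp: extends_def V5_def E5_def)
  have kill: "\<not> (\<phi> p = \<alpha> \<and> \<phi> z \<in> A \<and> \<phi> t \<in> B)" if col: "L_colouring V5 E5 L5 \<phi>" for \<phi>
  proof
    assume h: "\<phi> p = \<alpha> \<and> \<phi> z \<in> A \<and> \<phi> t \<in> B"
    have e: "\<phi> a \<noteq> \<phi> b" if "{a, b} \<in> E5" for a b using col that by (auto simp: L_colouring_def)
    have neq: "\<phi> x \<noteq> \<phi> p" "\<phi> x \<noteq> \<phi> z" "\<phi> x \<noteq> \<phi> t" "\<phi> v \<noteq> \<phi> x" "\<phi> v \<noteq> \<phi> p" "\<phi> v \<noteq> \<phi> z"
      "\<phi> w \<noteq> \<phi> v" "\<phi> w \<noteq> \<phi> x" "\<phi> w \<noteq> \<phi> z" "\<phi> v' \<noteq> \<phi> x" "\<phi> v' \<noteq> \<phi> p" "\<phi> v' \<noteq> \<phi> t"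
      "\<phi> w' \<noteq> \<phi> v'" "\<phi> w' \<noteq> \<phi> x" "\<phi> w' \<noteq> \<phi> t"
      by (rule e, simp add: E5_def)+
    have "\<phi> x \<in> L5 x" "\<phi> v \<in> L5 v" "\<phi> w \<in> L5 w" "\<phi> v' \<in> L5 v'" "\<phi> w' \<in> L5 w'"
      using col by (auto simp: L_colouring_def V5_def)
    \<comment> \<open>The colour \<alpha> of \<open>p\<close> is lost to its neighbours
      \<open>x\<close>, \<open>v\<close> and \<open>v'\<close>.\<close>
    hence mem: "\<phi> x \<in> A \<or> \<phi> x \<in> B" "\<phi> v \<in> A" "\<phi> w \<in> A" "\<phi> v' \<in> B" "\<phi> w' \<in> B"
      using h neq by (auto simp: L5)
    from mem(1) show False
    proof
      assume "\<phi> x \<in> A"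
      thus False using small_list_collision[OF A, of "\<phi> x" "\<phi> v" "\<phi> w" "\<phi> z"] mem h neq by auto
    next
      assume "\<phi> x \<in> B"
      thus False using small_list_collision[OF B, of "\<phi> x" "\<phi> v'" "\<phi> w'" "\<phi> t"] mem h neq by auto
    qed
  qed
  show ?thesis by (rule that[OF cf5 ext faces]) (use kill in blast)
qed

section \<open>Forbidding all colourings\<close>

text \<open>One round of the construction. It hands back a face at the edge \<open>pq\<close> whose
  third corner has a large list, so that rounds can be iterated; the growth of the vertex set serves
  the final vertex count.\<close>

lemma forbid_pair:
  assumes cf: "config V E F L" and f: "{p, q, y} \<in> F"
    and big: "8 \<le> card (L p)" "8 \<le> card (L q)" "8 \<le> card (L y)"
    and \<alpha>\<beta>: "\<alpha> < 16" "\<beta> < 16" "\<alpha> \<noteq> \<beta>"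
  obtains V' E' F' L' y' where "config V' E' F' L'" "extends V E L V' E' L'" "{p, q, y'} \<in> F'"
    "8 \<le> card (L' y')" "card V < card V'"
    "\<forall>\<phi>. L_colouring V' E' L' \<phi> \<longrightarrow> \<not> (\<phi> p = \<alpha> \<and> \<phi> q = \<beta>)"
proof -
  note pqy = config_face[OF cf f]
  have fin: "finite V" using cf stacked_finite by (auto simp: config_def)
  obtain n where n: "\<forall>u\<in>V. u < n" using fin by (meson finite_nat_set_iff_bounded)
  obtain a z b where fresh: "a \<notin> V" "z \<notin> V" "b \<notin> V" and d: "a \<noteq> z" "a \<noteq> b" "z \<noteq> b"
  proof (rule that[of n "n + 1" "n + 2"])
  qed (use n in auto)
  have ne: "u \<noteq> a" "u \<noteq> z" "u \<noteq> b" if "u \<in> V" for u using that fresh by auto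
  note ne' = ne[OF pqy(1)] ne[OF pqy(2)] ne[OF pqy(3)]
  \<comment> \<open>The colours of the poles are below 16, so these blocks avoid them. Two pole
    colours and two blocks of three make lists of size 8.\<close>
  define A B C D where "A = {16, 17, 18::nat}" and "B = {19, 20, 21::nat}"
    and "C = {22, 23, 24::nat}" and "D = {25, 26, 27::nat}"
  note defs = A_def B_def C_def D_def
  have three: "card A = 3" "card B = 3" "card C = 3" "card D = 3" by (simp_all add: defs)
  have disj: "A \<inter> C = {}" "A \<inter> D = {}" "B \<inter> C = {}" "B \<inter> D = {}"
    "\<alpha> \<notin> A" "\<alpha> \<notin> B" "\<alpha> \<notin> C" "\<alpha> \<notin> D" "\<beta> \<notin> A" "\<beta> \<notin> B" "\<beta> \<notin> C" "\<beta> \<notin> D"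
    using \<alpha>\<beta> by (auto simp: defs)
  define Lz Lt where "Lz = {\<alpha>, \<beta>} \<union> A \<union> B" and "Lt = {\<alpha>, \<beta>} \<union> C \<union> D"
  have eight: "card Lz = 8" "card Lt = 8" using \<alpha>\<beta> by (auto simp: Lz_def Lt_def defs card_insert_if)
  define L1 where "L1 = L(a := Lt)"
  define L2 where "L2 = L1(z := Lz)"
  define L3 where "L3 = L2(b := Lt)"
  have L3: "L3 a = Lt" "L3 z = Lz" "L3 b = Lt" "L3 p = L p" "L3 q = L q"
    using d ne' by (auto simp: L3_def L2_def L1_def)
  define V3 where "V3 = insert b (insert z (insert a V))"
  define E3 where "E3 = E \<union> {{a, p}, {a, q}, {a, y}} \<union> {{z, a}, {z, p}, {z, q}} \<union> {{b, z}, {b, p}, {b, q}}"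
  \<comment> \<open>Each of \<open>a\<close>, \<open>z\<close>, \<open>b\<close> is inserted into
    the current face at the edge \<open>pq\<close>, which creates the path and leaves the face
    \<open>{p, q, b}\<close> free.\<close>
  obtain F1 where F1: "config (insert a V) (E \<union> {{a, p}, {a, q}, {a, y}}) F1 L1"
    "extends V E L (insert a V) (E \<union> {{a, p}, {a, q}, {a, y}}) L1" "{a, p, q} \<in> F1"
    by (rule config_insert[OF cf f fresh(1) big eight(2), folded L1_def]) (rule that; assumption)
  have z: "z \<notin> insert a V" using fresh d by auto
  have big1: "8 \<le> card (L1 a)" "8 \<le> card (L1 p)" "8 \<le> card (L1 q)"
    using eight big ne' by (auto simp: L1_def)
  obtain F2 where F2: "config (insert z (insert a V)) (E \<union> {{a, p}, {a, q}, {a, y}} \<union> {{z, a}, {z, p}, {z, q}}) F2 L2"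
    "extends (insert a V) (E \<union> {{a, p}, {a, q}, {a, y}}) L1
      (insert z (insert a V)) (E \<union> {{a, p}, {a, q}, {a, y}} \<union> {{z, a}, {z, p}, {z, q}}) L2"
    "{z, p, q} \<in> F2" "{z, a, q} \<in> F2" "{z, a, p} \<in> F2"
    by (rule config_insert[OF F1(1,3) z big1 eight(1), folded L2_def]) (rule that; assumption)
  have b: "b \<notin> insert z (insert a V)" using fresh d by auto
  have big2: "8 \<le> card (L2 z)" "8 \<le> card (L2 p)" "8 \<le> card (L2 q)"
    using eight big1 ne' by (auto simp: L2_def)
  obtain F3 where F3: "config V3 E3 F3 L3"
    "extends (insert z (insert a V)) (E \<union> {{a, p}, {a, q}, {a, y}} \<union> {{z, a}, {z, p}, {z, q}}) L2 V3 E3 L3"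
    "F2 - {{z, p, q}} \<subseteq> F3" "{b, p, q} \<in> F3" "{b, z, q} \<in> F3" "{b, z, p} \<in> F3"
    by (rule config_insert[OF F2(1,3) b big2 eight(2), folded L3_def V3_def E3_def]) (rule that; assumption)
  have ext3: "extends V E L V3 E3 L3" by (rule extends_trans[OF extends_trans[OF F1(2) F2(2)] F3(2)])
  have distinct_faces: "{z, a, q} \<noteq> {z, p, q}" "{z, a, p} \<noteq> {z, p, q}" using ne' d pqy by auto
  have faces: "{p, q, b} \<in> F3" "{p, z, a} \<in> F3" "{q, z, a} \<in> F3" "{p, z, b} \<in> F3" "{q, z, b} \<in> F3"
  proof -
    have "{z, a, p} \<in> F3" "{z, a, q} \<in> F3" using F3(3) F2(4,5) distinct_faces by blast+
    moreover have "{p, q, b} = {b, p, q}" "{p, z, a} = {z, a, p}" "{q, z, a} = {z, a, q}"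
      "{p, z, b} = {b, z, p}" "{q, z, b} = {b, z, q}" by auto
    ultimately show "{p, q, b} \<in> F3" "{p, z, a} \<in> F3" "{q, z, a} \<in> F3" "{p, z, b} \<in> F3" "{q, z, b} \<in> F3"
      using F3(4-6) by simp_all
  qed
  have inV3: "p \<in> V3" "q \<in> V3" "a \<in> V3" "z \<in> V3" "b \<in> V3" using pqy by (auto simp: V3_def)
  have big3: "8 \<le> card (L3 p)" "8 \<le> card (L3 q)" "8 \<le> card (L3 a)" "8 \<le> card (L3 z)" "8 \<le> card (L3 b)"
    using L3 eight big by auto
  have big_ext: "8 \<le> card (L' p)" "8 \<le> card (L' q)" "8 \<le> card (L' a)" "8 \<le> card (L' z)" "8 \<le> card (L' b)"
    if "extends V3 E3 L3 V' E' L'" for V' E' L'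
    using that inV3 big3 unfolding extends_def by auto
  \<comment> \<open>The four gadget faces and the free face are pairwise distinct, so filling one
    keeps the others.\<close>
  have neI: "X \<noteq> Y" if "u \<in> X" "u \<notin> Y" for u and X Y :: "nat set" using that by auto
  have nf_p: "{p, z, a} \<noteq> {q, z, a}" "{p, z, b} \<noteq> {q, z, b}"
    by (rule neI[of p]; use ne' pqy in simp)+
  have nf_a: "{p, z, a} \<noteq> {p, z, b}" "{p, z, a} \<noteq> {q, z, b}" "{p, z, a} \<noteq> {p, q, b}"
    "{q, z, a} \<noteq> {p, z, b}" "{q, z, a} \<noteq> {q, z, b}" "{q, z, a} \<noteq> {p, q, b}"
    by (rule neI[of a]; use ne' d in simp)+
  have nf_z: "{p, z, b} \<noteq> {p, q, b}" "{q, z, b} \<noteq> {p, q, b}"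
    by (rule neI[of z]; use ne' d in simp)+
  note nf = nf_p nf_a nf_z
  have keep: "X \<in> H'" if "H - {Y} \<subseteq> H'" "X \<in> H" "Y \<noteq> X" for X Y :: "nat set" and H H'
    using that by auto
  \<comment> \<open>Gadgets at the pole \<open>p\<close> handle the block \<open>C\<close> and those
    at \<open>q\<close> the block \<open>D\<close>; gadgets at \<open>a\<close> exclude
    \<open>B\<close> for \<open>z\<close>, those at \<open>b\<close> exclude
    \<open>A\<close>.\<close>
  obtain V4 E4 F4 L4 where G4: "config V4 E4 F4 L4" "extends V3 E3 L3 V4 E4 L4" "F3 - {{p, z, a}} \<subseteq> F4"
    "\<forall>\<phi>. L_colouring V4 E4 L4 \<phi> \<longrightarrow> \<not> (\<phi> p = \<alpha> \<and> \<phi> z \<in> B \<and> \<phi> a \<in> C)"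
    by (rule gadget[OF F3(1) faces(2) big3(1,4,3) three(2,3) disj(3,6,7)])
  note big4 = big_ext[OF G4(2)]
  have f4: "{q, z, a} \<in> F4" "{p, z, b} \<in> F4" "{q, z, b} \<in> F4" "{p, q, b} \<in> F4"
    by (rule keep[OF G4(3)]; fact faces nf)+
  obtain V5 E5 F5 L5 where G5: "config V5 E5 F5 L5" "extends V4 E4 L4 V5 E5 L5" "F4 - {{q, z, a}} \<subseteq> F5"
    "\<forall>\<phi>. L_colouring V5 E5 L5 \<phi> \<longrightarrow> \<not> (\<phi> q = \<beta> \<and> \<phi> z \<in> B \<and> \<phi> a \<in> D)"
    by (rule gadget[OF G4(1) f4(1) big4(2,4,3) three(2,4) disj(4,10,12)])
  note ext5 = extends_trans[OF G4(2) G5(2)]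
  note big5 = big_ext[OF ext5]
  have f5: "{p, z, b} \<in> F5" "{q, z, b} \<in> F5" "{p, q, b} \<in> F5"
    by (rule keep[OF G5(3)]; fact f4 nf)+
  obtain V6 E6 F6 L6 where G6: "config V6 E6 F6 L6" "extends V5 E5 L5 V6 E6 L6" "F5 - {{p, z, b}} \<subseteq> F6"
    "\<forall>\<phi>. L_colouring V6 E6 L6 \<phi> \<longrightarrow> \<not> (\<phi> p = \<alpha> \<and> \<phi> z \<in> A \<and> \<phi> b \<in> C)"
    by (rule gadget[OF G5(1) f5(1) big5(1,4,5) three(1,3) disj(1,5,7)])
  note ext6 = extends_trans[OF ext5 G6(2)]
  note big6 = big_ext[OF ext6]
  have f6: "{q, z, b} \<in> F6" "{p, q, b} \<in> F6"
    by (rule keep[OF G6(3)]; fact f5 nf)+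
  obtain V7 E7 F7 L7 where G7: "config V7 E7 F7 L7" "extends V6 E6 L6 V7 E7 L7" "F6 - {{q, z, b}} \<subseteq> F7"
    "\<forall>\<phi>. L_colouring V7 E7 L7 \<phi> \<longrightarrow> \<not> (\<phi> q = \<beta> \<and> \<phi> z \<in> A \<and> \<phi> b \<in> D)"
    by (rule gadget[OF G6(1) f6(1) big6(2,4,5) three(1,4) disj(2,9,12)])
  note ext7 = extends_trans[OF ext6 G7(2)]
  note big7 = big_ext[OF ext7]
  have f7: "{p, q, b} \<in> F7" by (rule keep[OF G7(3)]; fact f6 nf)
  have "finite V7" using G7(1) stacked_finite by (auto simp: config_def)
  moreover have "V \<subset> V7" using ext7 fresh by (auto simp: extends_def V3_def)
  ultimately have card: "card V < card V7" by (rule psubset_card_mono)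
  have kill: "\<not> (\<phi> p = \<alpha> \<and> \<phi> q = \<beta>)" if c7: "L_colouring V7 E7 L7 \<phi>" for \<phi>
  proof
    assume h: "\<phi> p = \<alpha> \<and> \<phi> q = \<beta>"
    \<comment> \<open>The colouring is restricted to each intermediate stage, where the ban of the
      corresponding gadget is available.\<close>
    note c6 = extends_colouring[OF G7(2) c7]
    note c5 = extends_colouring[OF G6(2) c6]
    note c4 = extends_colouring[OF G5(2) c5]
    note c3 = extends_colouring[OF G4(2) c4]
    have e: "\<phi> u \<noteq> \<phi> v" if "{u, v} \<in> E3" for u v using c3 that by (auto simp: L_colouring_def)
    have neq: "\<phi> a \<noteq> \<phi> p" "\<phi> a \<noteq> \<phi> q" "\<phi> z \<noteq> \<phi> p" "\<phi> z \<noteq> \<phi> q" "\<phi> b \<noteq> \<phi> p" "\<phi> b \<noteq> \<phi> q"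
      by (rule e, simp add: E3_def)+
    have "\<phi> a \<in> Lt" "\<phi> z \<in> Lz" "\<phi> b \<in> Lt"
      using c3 inV3(3-5) L3(1-3) unfolding L_colouring_def by auto
    hence "\<phi> z \<in> A \<or> \<phi> z \<in> B" "\<phi> a \<in> C \<or> \<phi> a \<in> D" "\<phi> b \<in> C \<or> \<phi> b \<in> D"
      using h neq by (auto simp: Lz_def Lt_def)
    thus False using h G4(4)[rule_format, OF c4] G5(4)[rule_format, OF c5]
        G6(4)[rule_format, OF c6] G7(4)[rule_format, OF c7] by blast
  qed
  show ?thesis
    by (rule that[OF G7(1) extends_trans[OF ext3 ext7] f7 big7(5) card]) (use kill in blast)
qed

text \<open>Induction on the set of forbidden colour pairs of the poles 0 and 1, starting from a
  bare triangle. The disjoint pole lists make every pair consist of different colours, as one round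
  requires.\<close>

lemma forbid_pairs:
  assumes "finite D" "D \<subseteq> {0..<8::nat} \<times> {8..<16::nat}"
  shows "\<exists>V E F L y. config V E F L \<and> {0, 1, y} \<in> F \<and> L 0 = {0..<8} \<and> L 1 = {8..<16} \<and>
    8 \<le> card (L y) \<and> card D \<le> card V \<and> (\<forall>\<phi>. L_colouring V E L \<phi> \<longrightarrow> (\<phi> 0, \<phi> 1) \<notin> D)"
  using assms
proof (induction rule: finite_induct)
  case empty
  let ?V = "{0, 1, 2::nat}" and ?E = "{e. \<exists>u\<in>{0, 1, 2::nat}. \<exists>v\<in>{0, 1, 2}. u \<noteq> v \<and> e = {u, v}}"
    and ?L = "\<lambda>v::nat. if v = 1 then {8..<16} else {0..<8::nat}"
  have "stacked ?V ?E {?V}" by (rule stacked.triangle) simp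
  hence "config ?V ?E {?V} ?L" unfolding config_def by (simp add: f_list_assignment_def)
  thus ?case
    by (intro exI[of _ ?V] exI[of _ ?E] exI[of _ "{?V}"] exI[of _ ?L] exI[of _ 2]) simp
next
  case (insert d D)
  then obtain V E F L y where IH: "config V E F L" "{0, 1, y} \<in> F" "L 0 = {0..<8}" "L 1 = {8..<16}"
    "8 \<le> card (L y)" "card D \<le> card V" "\<forall>\<phi>. L_colouring V E L \<phi> \<longrightarrow> (\<phi> 0, \<phi> 1) \<notin> D" by auto
  obtain \<alpha> \<beta> where d: "d = (\<alpha>, \<beta>)" "\<alpha> < 16" "\<beta> < 16" "\<alpha> \<noteq> \<beta>"
    using insert.prems by (cases d) auto
  have big: "8 \<le> card (L 0)" "8 \<le> card (L 1)" using IH by auto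
  obtain V' E' F' L' y' where s: "config V' E' F' L'" "extends V E L V' E' L'" "{0, 1, y'} \<in> F'"
    "8 \<le> card (L' y')" "card V < card V'"
    "\<forall>\<phi>. L_colouring V' E' L' \<phi> \<longrightarrow> \<not> (\<phi> 0 = \<alpha> \<and> \<phi> 1 = \<beta>)"
    by (rule forbid_pair[OF IH(1,2) big IH(5) d(2-4)])
  have "L' 0 = {0..<8}" "L' 1 = {8..<16}"
    using s(2) IH(3,4) config_face[OF IH(1,2)] by (auto simp: extends_def)
  moreover have "card (insert d D) \<le> card V'" using insert.hyps IH(6) s(5) by simp
  moreover have "(\<phi> 0, \<phi> 1) \<notin> insert d D" if "L_colouring V' E' L' \<phi>" for \<phi>
    using that s(6) d(1) IH(7) extends_colouring[OF s(2) that] by auto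
  ultimately show ?case using s(1,3,4) by blast
qed

theorem theorem1:
  shows "\<exists>(V :: nat set) (E :: nat set set).
           simple_graph V E \<and> k_connected 3 V E \<and> planar V E \<and>
           \<not> complete_graph V E \<and> \<not> degree_truncated_choosable 8 V E"
proof -
  let ?D = "{0..<8::nat} \<times> {8..<16::nat}"
  obtain V E F L y where h: "config V E F L" "{0, 1, y} \<in> F" "L 0 = {0..<8}" "L 1 = {8..<16}"
    "card ?D \<le> card V" "\<forall>\<phi>. L_colouring V E L \<phi> \<longrightarrow> (\<phi> 0, \<phi> 1) \<notin> ?D"
    using forbid_pairs[of ?D] by auto
  have st: "stacked V E F" and la: "f_list_assignment V (\<lambda>v. min 8 (degree V E v)) L"
    using h(1) by (auto simp: config_def)
  \<comment> \<open>There is at least one vertex per forbidden pair, more than 3-connectivity and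
    non-completeness ask for.\<close>
  have card: "64 \<le> card V" using h(5) by simp
  have "\<not> L_colouring V E L \<phi>" for \<phi>
  proof
    assume col: "L_colouring V E L \<phi>"
    hence "\<phi> 0 \<in> L 0" "\<phi> 1 \<in> L 1" using config_face[OF h(1,2)] by (auto simp: L_colouring_def)
    thus False using h(3,4,6) col by auto
  qed
  hence "\<not> degree_truncated_choosable 8 V E"
    using la unfolding degree_truncated_choosable_def f_choosable_def by blast
  moreover obtain p where "drawing V E F p" using stacked_drawing[OF st] ..
  hence "planar V E" by (rule drawing_planar[OF _ stacked_simple[OF st]])
  ultimately show ?thesis
    using stacked_simple[OF st] stacked_k_connected[OF st] stacked_not_complete[OF st] card by auto
qed

end
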